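(* Let $G=(V,E)$ be a finite connected graph with maximal degree $\Delta$ whose resistance curvature is bounded from below by $K>0$, i.e. $\kappa_v \geq K$ for every $v\in V$. Then $$\operatorname{diam}(G) \leq \left\lceil \sqrt{\frac{\Delta}{K}}\cdot \log |V| \right\rceil .$$
   Context: Throughout, $G=(V,E)$ is a finite, simple, connected (combinatorial) graph with vertices $v_1,\dots,v_n$, $n\ge 2$. Let $D$ be the diagonal degree matrix, $A$ the adjacency matrix, $L=D-A$ the Laplacian, and let $\Gamma = D-A+\frac1n J$, where $J$ is the $n\times n$ all-ones matrix. The resistance matrix $\Omega\in\mathbb{R}^{n\times n}$ is defined by $\Omega_{ij}=(\Gamma^{-1})_{ii}+(\Gamma^{-1})_{jj}-2(\Gamma^{-1})_{ij}$ (the effective resistance between $v_i$ and $v_j$); $\Omega$ is invertible. The resistance curvature is the unique vector $\kappa=(\kappa_1,\dots,\kappa_n)\in\mathbb{R}^n$ solving $\Omega\kappa=\mathbf{1}$, where $\mathbf 1=(1,\dots,1)$; $\kappa_i$ is the curvature at vertex $v_i$. $\operatorname{diam}(G)$ is the graph-distance diameter. *)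

theory Defs
  imports "HOL-Analysis.Analysis"
begin

text \<open>
  A graph is given by its adjacency relation on a finite type: the vertex set is the whole type
  \<open>'v\<close>, so \<open>n = CARD('v)\<close>, and vectors and matrices over the vertices
  have the types \<open>real ^ 'v\<close> and \<open>real ^ 'v ^ 'v\<close>.
\<close>

definition simple_graph :: "('v \<Rightarrow> 'v \<Rightarrow> bool) \<Rightarrow> bool" where
  "simple_graph E \<longleftrightarrow> symp E \<and> irreflp E"

definition connected_graph :: "('v \<Rightarrow> 'v \<Rightarrow> bool) \<Rightarrow> bool" where
  "connected_graph E \<longleftrightarrow> (\<forall>u v. E\<^sup>*\<^sup>* u v)"

definition vertex_degree :: "('v::finite \<Rightarrow> 'v \<Rightarrow> bool) \<Rightarrow> 'v \<Rightarrow> nat" where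
  "vertex_degree E v = card {u. E v u}"

definition max_degree :: "('v::finite \<Rightarrow> 'v \<Rightarrow> bool) \<Rightarrow> nat" where
  "max_degree E = Max (range (vertex_degree E))"

text \<open>
  The relational power \<open>(E ^^ k) u v\<close> says that there is a walk of length
  \<open>k\<close> from \<open>u\<close> to \<open>v\<close>. The distance is meaningful only if
  some walk exists, in particular for connected graphs.
\<close>

definition graph_dist :: "('v \<Rightarrow> 'v \<Rightarrow> bool) \<Rightarrow> 'v \<Rightarrow> 'v \<Rightarrow> nat" where
  "graph_dist E u v = (LEAST k. (E ^^ k) u v)"

definition graph_diam :: "('v::finite \<Rightarrow> 'v \<Rightarrow> bool) \<Rightarrow> nat" where
  "graph_diam E = Max (range (\<lambda>(u, v). graph_dist E u v))"

definition degree_matrix :: "('v::finite \<Rightarrow> 'v \<Rightarrow> bool) \<Rightarrow> real ^ 'v ^ 'v" where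
  "degree_matrix E = (\<chi> i j. if i = j then real (vertex_degree E i) else 0)"

definition adjacency_matrix :: "('v::finite \<Rightarrow> 'v \<Rightarrow> bool) \<Rightarrow> real ^ 'v ^ 'v" where
  "adjacency_matrix E = (\<chi> i j. if E i j then 1 else 0)"

definition laplacian :: "('v::finite \<Rightarrow> 'v \<Rightarrow> bool) \<Rightarrow> real ^ 'v ^ 'v" where
  "laplacian E = degree_matrix E - adjacency_matrix E"

definition all_ones_matrix :: "real ^ 'v ^ 'v::finite" where
  "all_ones_matrix = (\<chi> i j. 1)"

definition gamma_matrix :: "('v::finite \<Rightarrow> 'v \<Rightarrow> bool) \<Rightarrow> real ^ 'v ^ 'v" where
  "gamma_matrix E = laplacian E + (1 / real CARD('v)) *\<^sub>R all_ones_matrix"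

definition resistance_matrix :: "('v::finite \<Rightarrow> 'v \<Rightarrow> bool) \<Rightarrow> real ^ 'v ^ 'v" where
  "resistance_matrix E = (let H = matrix_inv (gamma_matrix E)
     in \<chi> i j. H $ i $ i + H $ j $ j - 2 * H $ i $ j)"

text \<open>
  For a connected graph with at least two vertices the resistance matrix is invertible,
  so the description below denotes a unique vector.
\<close>

definition resistance_curvature :: "('v::finite \<Rightarrow> 'v \<Rightarrow> bool) \<Rightarrow> real ^ 'v" where
  "resistance_curvature E = (THE \<kappa>. resistance_matrix E *v \<kappa> = (\<chi> i. 1))"

end

theory Submission
  imports Defs
begin

text \<open>
  Thomson's principle gives \<open>(f i - f j)\<^sup>2 \<le> \<Omega> i j * \<E> f\<close> for the Dirichlet energy \<open>\<E>\<close>.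
  Weighting by the curvature and using \<open>\<Omega> \<kappa> = 1\<close> yields the pointwise inequality
  \<open>K * (\<Sum>j. (f i - f j)\<^sup>2) \<le> \<E> f\<close> for every vertex \<open>i\<close>. Take \<open>f = d(x, _)\<close>, which has energy at
  most \<open>n \<Delta> / 2\<close>, and add the inequalities at \<open>x\<close> and at a vertex \<open>y\<close> at distance \<open>D\<close>: since
  \<open>(f x - f v)\<^sup>2 + (f y - f v)\<^sup>2 \<ge> D\<^sup>2 / 2\<close>, this gives \<open>D\<^sup>2 \<le> 2 \<Delta> / K\<close>. This beats the logarithmic
  bound as soon as \<open>n \<ge> 5\<close>; for smaller \<open>n\<close>, rounding up and \<open>D \<le> n - 1\<close> make up the difference.
\<close>

section \<open>Dirichlet energy and the Laplacian\<close>

text \<open>The sum runs over ordered pairs, so each edge of a symmetric \<open>E\<close> occurs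
  twice; the factor 1/2 compensates.\<close>

definition dirichlet_form :: "('v::finite \<Rightarrow> 'v \<Rightarrow> bool) \<Rightarrow> real ^ 'v \<Rightarrow> real ^ 'v \<Rightarrow> real" where
  "dirichlet_form E f g = (\<Sum>(u, v) \<in> {(u, v). E u v}. (f $ u - f $ v) * (g $ u - g $ v)) / 2"

lemma dirichlet_form_commute: "dirichlet_form E f g = dirichlet_form E g f"
  by (simp add: dirichlet_form_def mult.commute)

lemma dirichlet_form_nonneg: "0 \<le> dirichlet_form E f f"
  unfolding dirichlet_form_def by (intro divide_nonneg_pos sum_nonneg) auto

lemma dirichlet_form_Cauchy_Schwarz:
  "(dirichlet_form E f g)\<^sup>2 \<le> dirichlet_form E f f * dirichlet_form E g g"
  using Cauchy_Schwarz_ineq_sum[of "\<lambda>(u, v). f $ u - f $ v" "\<lambda>(u, v). g $ u - g $ v" "{(u, v). E u v}"]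
  by (simp add: dirichlet_form_def case_prod_beta power_divide flip: power2_eq_square)

lemma laplacian_mult_nth:
  "(laplacian E *v f) $ i = (\<Sum>j\<in>UNIV. if E i j then f $ i - f $ j else 0)"
proof -
  have "(laplacian E *v f) $ i
      = (\<Sum>j\<in>UNIV. (if i = j then real (vertex_degree E i) * f $ j else 0))
        - (\<Sum>j\<in>UNIV. if E i j then f $ j else 0)"
    unfolding sum_subtractf[symmetric]
    by (auto simp: laplacian_def degree_matrix_def adjacency_matrix_def matrix_vector_mult_def
        algebra_simps intro!: sum.cong)
  also have "(\<Sum>j\<in>UNIV. (if i = j then real (vertex_degree E i) * f $ j else 0))
      = (\<Sum>j\<in>UNIV. if E i j then f $ i else 0)"
    by (simp add: vertex_degree_def sum.If_cases)
  finally show ?thesis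
    unfolding sum_subtractf[symmetric] by (auto intro!: sum.cong)
qed

text \<open>Summation by parts: exchanging the two ends of every edge gives a second expression for
  the same sum, and averaging the two produces the differences of \<open>f\<close>.\<close>

lemma inner_laplacian_mult:
  assumes "symp E"
  shows "f \<bullet> (laplacian E *v g) = dirichlet_form E f g"
proof -
  let ?S = "\<lambda>h. \<Sum>i\<in>UNIV. \<Sum>j\<in>UNIV. if E i j then h i j * (g $ i - g $ j) else 0"
  have swap: "(if E j i then f $ j * (g $ j - g $ i) else 0)
      = (if E i j then - f $ j * (g $ i - g $ j) else 0)" for i j
    using sympD[OF assms, of i j] sympD[OF assms, of j i] by (simp add: algebra_simps)
  have 1: "f \<bullet> (laplacian E *v g) = ?S (\<lambda>i j. f $ i)"
    by (auto simp: inner_vec_def laplacian_mult_nth sum_distrib_left intro!: sum.cong)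
  have "?S (\<lambda>i j. f $ i) = (\<Sum>j\<in>UNIV. \<Sum>i\<in>UNIV. if E i j then f $ i * (g $ i - g $ j) else 0)"
    by (rule sum.swap)
  also have "\<dots> = ?S (\<lambda>i j. - f $ j)"
    by (intro sum.cong refl) (rule swap)
  finally have "2 * (f \<bullet> (laplacian E *v g)) = ?S (\<lambda>i j. f $ i) + ?S (\<lambda>i j. - f $ j)"
    using 1 by simp
  also have "\<dots> = ?S (\<lambda>i j. f $ i - f $ j)"
    unfolding sum.distrib[symmetric] by (auto simp: algebra_simps intro!: sum.cong)
  also have "\<dots> = (\<Sum>(u, v)\<in>UNIV. if E u v then (f $ u - f $ v) * (g $ u - g $ v) else 0)"
    by (simp add: sum.cartesian_product)
  also have "\<dots> = 2 * dirichlet_form E f g"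
    by (simp add: dirichlet_form_def case_prod_beta' sum.If_cases)
  finally show ?thesis by simp
qed

lemma dirichlet_form_eq_0_imp_constant:
  assumes "connected_graph E" and "dirichlet_form E f f = 0"
  shows "f $ u = f $ v"
proof -
  have "(\<Sum>(u, v) \<in> {(u, v). E u v}. (f $ u - f $ v) * (f $ u - f $ v)) = 0"
    using assms(2) by (simp add: dirichlet_form_def)
  then have step: "f $ u = f $ v" if "E u v" for u v
    by (subst (asm) sum_nonneg_eq_0_iff) (use that in auto)
  have "E\<^sup>*\<^sup>* u v"
    using assms(1) by (auto simp: connected_graph_def)
  then show ?thesis
    by (induction rule: rtranclp_induct) (auto dest: step)
qed

lemma card_le_max_degree:
  "card {(u, v). E u v} \<le> CARD('v) * max_degree (E :: 'v::finite \<Rightarrow> 'v \<Rightarrow> bool)"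
proof -
  have "card {(u, v). E u v} = card (SIGMA u:UNIV. {v. E u v})"
    by (rule arg_cong[where f = card]) auto
  also have "\<dots> = (\<Sum>u\<in>UNIV. vertex_degree E u)"
    by (simp add: vertex_degree_def)
  also have "\<dots> \<le> (\<Sum>u\<in>(UNIV :: 'v set). max_degree E)"
    by (intro sum_mono) (auto simp: max_degree_def)
  finally show ?thesis by simp
qed

lemma dirichlet_form_le_of_Lipschitz:
  fixes E :: "'v::finite \<Rightarrow> 'v \<Rightarrow> bool"
  assumes "\<And>u v. E u v \<Longrightarrow> \<bar>f $ u - f $ v\<bar> \<le> 1"
  shows "dirichlet_form E f f \<le> real CARD('v) * real (max_degree E) / 2"
proof -
  have "(f $ u - f $ v) * (f $ u - f $ v) \<le> 1" if "E u v" for u v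
    using assms[OF that] by (metis abs_square_le_1 power2_eq_square)
  then have "(\<Sum>(u, v) \<in> {(u, v). E u v}. (f $ u - f $ v) * (f $ u - f $ v))
      \<le> (\<Sum>(u, v) \<in> {(u, v). E u v}. 1)"
    by (intro sum_mono) auto
  also have "\<dots> = real (card {(u, v). E u v})"
    by (simp add: case_prod_beta)
  also have "\<dots> \<le> real (CARD('v) * max_degree E)"
    using card_le_max_degree[of E] by (simp only: of_nat_le_iff)
  finally show ?thesis
    by (simp add: dirichlet_form_def)
qed

section \<open>The Gamma matrix and its inverse\<close>

lemma gamma_mult:
  "gamma_matrix E *v f = laplacian E *v f + (\<chi> i. (1 \<bullet> f) / real CARD('v))"
  for E :: "'v::finite \<Rightarrow> 'v \<Rightarrow> bool"
  by (simp add: gamma_matrix_def all_ones_matrix_def matrix_vector_mult_add_rdistrib vec_eq_iff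
      matrix_vector_mult_def inner_vec_def sum_divide_distrib distrib_right sum.distrib)

lemma inner_gamma_mult:
  fixes E :: "'v::finite \<Rightarrow> 'v \<Rightarrow> bool"
  assumes "symp E"
  shows "f \<bullet> (gamma_matrix E *v g) = dirichlet_form E f g + (1 \<bullet> f) * (1 \<bullet> g) / real CARD('v)"
proof -
  have "f \<bullet> (\<chi> i. c) = (1 \<bullet> f) * c" for c
    by (simp add: inner_vec_def sum_distrib_right)
  then show ?thesis
    by (simp add: gamma_mult inner_add_right inner_laplacian_mult[OF assms])
qed

text \<open>The energy vanishes only on constants because the graph is connected, and the all-ones
  term is positive on nonzero constants.\<close>

lemma inner_gamma_mult_pos:
  fixes E :: "'v::finite \<Rightarrow> 'v \<Rightarrow> bool"
  assumes "symp E" and "connected_graph E" and "f \<noteq> 0"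
  shows "0 < f \<bullet> (gamma_matrix E *v f)"
proof -
  have nonneg: "0 \<le> dirichlet_form E f f" "0 \<le> (1 \<bullet> f) * (1 \<bullet> f) / real CARD('v)"
    by (auto simp: dirichlet_form_nonneg)
  moreover have False if "dirichlet_form E f f = 0" "(1 \<bullet> f) * (1 \<bullet> f) / real CARD('v) = 0"
  proof -
    have const: "f $ u = f $ v" for u v
      using dirichlet_form_eq_0_imp_constant[OF assms(2) that(1)] .
    have "f $ u = 0" for u
    proof -
      have "1 \<bullet> f = (\<Sum>v\<in>(UNIV::'v set). f $ u)"
        unfolding inner_vec_def by (intro sum.cong refl) (simp, rule const)
      then show ?thesis
        using that(2) by simp
    qed
    then show False
      using assms(3) by (simp add: vec_eq_iff)
  qed
  ultimately show ?thesis
    unfolding inner_gamma_mult[OF assms(1)]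
    by (metis add_nonneg_eq_0_iff add_nonneg_nonneg order_le_less)
qed

lemma invertible_gamma_matrix:
  assumes "symp E" and "connected_graph E"
  shows "invertible (gamma_matrix E)"
  unfolding invertible_left_inverse matrix_left_invertible_ker
  by (metis inner_gamma_mult_pos[OF assms] inner_zero_right less_irrefl)

text \<open>For symmetric connected \<open>E\<close> this is the Moore-Penrose inverse of the
  Laplacian plus the all-ones matrix divided by n; it inverts the Laplacian on vectors of coordinate
  sum zero.\<close>

abbreviation green :: "('v::finite \<Rightarrow> 'v \<Rightarrow> bool) \<Rightarrow> real ^ 'v ^ 'v" where
  "green E \<equiv> matrix_inv (gamma_matrix E)"

lemma gamma_green_mult:
  assumes "symp E" and "connected_graph E"
  shows "gamma_matrix E *v (green E *v f) = f"
proof -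
  have "gamma_matrix E ** green E = mat 1"
    using someI_ex[OF invertible_gamma_matrix[OF assms, unfolded invertible_def]]
    by (simp add: matrix_inv_def)
  then show ?thesis
    by (simp add: matrix_vector_mul_assoc)
qed

text \<open>Writing \<open>f\<close> as \<open>gamma_matrix E *v (green E *v f)\<close> transfers
  the symmetry of the Gamma form to the inverse.\<close>

lemma inner_green_mult_commute:
  assumes "symp E" and "connected_graph E"
  shows "f \<bullet> (green E *v g) = g \<bullet> (green E *v f)"
proof -
  have "f \<bullet> (green E *v g) = (green E *v g) \<bullet> (gamma_matrix E *v (green E *v f))"
    by (simp add: gamma_green_mult[OF assms] inner_commute)
  also have "\<dots> = (green E *v f) \<bullet> (gamma_matrix E *v (green E *v g))"
    by (simp add: inner_gamma_mult[OF assms(1)] dirichlet_form_commute mult.commute)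
  finally show ?thesis
    by (simp add: gamma_green_mult[OF assms] inner_commute)
qed

lemma inner_green_mult_pos:
  assumes "symp E" and "connected_graph E" and "f \<noteq> 0"
  shows "0 < f \<bullet> (green E *v f)"
proof -
  have "green E *v f \<noteq> 0"
    using gamma_green_mult[OF assms(1,2), of f] assms(3) by auto
  from inner_gamma_mult_pos[OF assms(1,2) this] show ?thesis
    by (simp add: gamma_green_mult[OF assms(1,2)] inner_commute)
qed

lemma green_nth_eq_inner: "green E $ i $ j = axis i 1 \<bullet> (green E *v axis j 1)"
  by (simp add: matrix_vector_mul_component inner_axis inner_axis')

section \<open>Effective resistance and invertibility of its matrix\<close>

lemma resistance_eq_inner:
  assumes "symp E" and "connected_graph E"
  shows "resistance_matrix E $ i $ j
    = (axis i 1 - axis j 1) \<bullet> (green E *v (axis i 1 - axis j 1))"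
  using inner_green_mult_commute[OF assms, of "axis i 1" "axis j 1"]
  by (simp add: resistance_matrix_def Let_def green_nth_eq_inner matrix_vector_mult_diff_distrib
      inner_diff_left inner_diff_right)

lemma resistance_pos:
  assumes "symp E" and "connected_graph E" and "i \<noteq> j"
  shows "0 < resistance_matrix E $ i $ j"
proof -
  have "axis i 1 - axis j 1 \<noteq> (0 :: real ^ 'a)"
    using assms(3) by (auto simp: axis_eq_axis)
  then show ?thesis
    unfolding resistance_eq_inner[OF assms(1,2)] by (rule inner_green_mult_pos[OF assms(1,2)])
qed

lemma resistance_self: "resistance_matrix E $ i $ i = 0"
  by (simp add: resistance_matrix_def Let_def)

text \<open>
  Thomson's principle: \<open>green E *v (axis i 1 - axis j 1)\<close> is the potential of the unit current
  from \<open>i\<close> to \<open>j\<close>, and its energy is the resistance.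
\<close>

lemma square_diff_le_resistance:
  fixes E :: "'v::finite \<Rightarrow> 'v \<Rightarrow> bool"
  assumes "symp E" and "connected_graph E"
  shows "(f $ i - f $ j)\<^sup>2 \<le> resistance_matrix E $ i $ j * dirichlet_form E f f"
proof -
  define z :: "real ^ 'v" where "z = axis i 1 - axis j 1"
  define w where "w = green E *v z"
  have gw: "gamma_matrix E *v w = z"
    unfolding w_def by (rule gamma_green_mult[OF assms])
  have const: "dirichlet_form E 1 w = 0"
    by (simp add: dirichlet_form_def)
  have "1 \<bullet> z = 0"
    by (simp add: z_def inner_diff_right inner_axis)
  \<comment> \<open>Testing against 1 shows that Gamma preserves the coordinate sum. Hence the
    all-ones term vanishes on \<open>w\<close>, and pairing with \<open>w\<close> in the Dirichlet
    form is the inner product with \<open>z\<close>.\<close>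
  moreover have "1 \<bullet> z = 1 \<bullet> w"
    using inner_gamma_mult[OF assms(1), of 1 w] const
    by (simp add: gw inner_vec_def)
  ultimately have sum_w: "1 \<bullet> w = 0" by simp
  have form_w: "dirichlet_form E g w = g \<bullet> z" for g
    using inner_gamma_mult[OF assms(1), of g w] by (simp add: gw sum_w)
  have "dirichlet_form E f w = f $ i - f $ j"
    by (simp add: form_w z_def inner_diff_right inner_axis)
  moreover have "dirichlet_form E w w = resistance_matrix E $ i $ j"
    by (simp add: form_w resistance_eq_inner[OF assms] flip: z_def) (simp add: w_def inner_commute)
  ultimately show ?thesis
    using dirichlet_form_Cauchy_Schwarz[of E f w] by (simp add: mult.commute)
qed

text \<open>The diagonal Green entries contribute rank-one matrices whose quadratic forms vanish on
  coordinate sum zero; what remains is -2 times the positive definite form of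
  \<open>green E\<close>.\<close>

lemma inner_resistance_mult_neg:
  fixes E :: "'v::finite \<Rightarrow> 'v \<Rightarrow> bool"
  assumes "symp E" and "connected_graph E" and "1 \<bullet> x = 0" and "x \<noteq> 0"
  shows "x \<bullet> (resistance_matrix E *v x) < 0"
proof -
  define h :: "real ^ 'v" where "h = (\<chi> i. green E $ i $ i)"
  have "resistance_matrix E *v x = (1 \<bullet> x) *\<^sub>R h + (\<chi> i. h \<bullet> x) - 2 *\<^sub>R (green E *v x)"
    by (simp add: vec_eq_iff resistance_matrix_def Let_def matrix_vector_mult_def inner_vec_def h_def
        algebra_simps sum.distrib sum_subtractf sum_distrib_left sum_distrib_right)
  then have "x \<bullet> (resistance_matrix E *v x) = (1 \<bullet> x) * (h \<bullet> x) - 2 * (x \<bullet> (green E *v x))"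
    by (simp add: assms(3) inner_diff_right) (use assms(3) in \<open>simp add: inner_vec_def flip: sum_distrib_right\<close>)
  then show ?thesis
    using inner_green_mult_pos[OF assms(1,2,4)] assms(3) by simp
qed

text \<open>
  A kernel vector \<open>x\<close> of the resistance matrix with nonzero coordinate sum could be rescaled so that
  \<open>1 - x\<close> has coordinate sum zero, but \<open>1\<close> and \<open>1 - x\<close> take the same value, which is positive,
  under the quadratic form.
\<close>

lemma invertible_resistance_matrix:
  fixes E :: "'v::finite \<Rightarrow> 'v \<Rightarrow> bool"
  assumes "symp E" and "connected_graph E" and "CARD('v) \<ge> 2"
  shows "invertible (resistance_matrix E)"
  unfolding invertible_left_inverse matrix_left_invertible_ker
proof (intro allI impI, rule ccontr)
  let ?R = "resistance_matrix E"
  fix x assume Rx: "?R *v x = 0" and "x \<noteq> 0"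
  then have s: "1 \<bullet> x \<noteq> 0"
    using inner_resistance_mult_neg[OF assms(1,2), of x] by auto
  \<comment> \<open>The vector 1 has coordinate sum n, so this factor makes the coordinate sum of
    \<open>y\<close> zero.\<close>
  define y where "y = 1 - (real CARD('v) / (1 \<bullet> x)) *\<^sub>R x"
  have "1 \<bullet> y = 0"
    using s by (simp add: y_def inner_diff_right) (simp add: inner_vec_def)
  then have "y \<bullet> (?R *v y) \<le> 0"
    using inner_resistance_mult_neg[OF assms(1,2), of y] by (cases "y = 0") auto
  moreover have Ry: "?R *v y = ?R *v 1"
    by (simp add: y_def matrix_vector_mult_diff_distrib matrix_vector_mult_scaleR Rx)
  have sym: "a \<bullet> (?R *v b) = b \<bullet> (?R *v a)" for a b
  proof -
    have "transpose ?R = ?R"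
    proof -
      have "?R $ i $ j = ?R $ j $ i" for i j
        using inner_green_mult_commute[OF assms(1,2), of "axis i 1" "axis j 1"]
        by (simp add: resistance_matrix_def Let_def green_nth_eq_inner)
      then show ?thesis
        by (simp add: transpose_def vec_eq_iff)
    qed
    then show ?thesis
      by (metis dot_lmul_matrix inner_commute vector_transpose_matrix)
  qed
  \<comment> \<open>\<open>Ry\<close> removes the kernel vector from the right argument; symmetry
    then lets it be removed from the left one too.\<close>
  have "y \<bullet> (?R *v y) = 1 \<bullet> (?R *v 1)"
    using sym[of y 1] by (simp add: Ry)
  \<comment> \<open>The value is the sum of all entries; two distinct vertices supply a positive
    one.\<close>
  moreover have "0 < 1 \<bullet> (?R *v 1)"
  proof -
    obtain i j :: 'v where "i \<noteq> j"
      using assms(3) card_le_Suc0_iff_eq[of "UNIV :: 'v set"] by auto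
    have nonneg: "0 \<le> ?R $ i $ j" for i j
      using resistance_pos[OF assms(1,2), of i j] resistance_self[of E i] by (cases "i = j") auto
    have "0 < ?R $ i $ j"
      using resistance_pos[OF assms(1,2) \<open>i \<noteq> j\<close>] .
    also have "\<dots> \<le> (\<Sum>j\<in>UNIV. ?R $ i $ j)"
      by (intro member_le_sum) (auto simp: nonneg)
    also have "\<dots> \<le> (\<Sum>i\<in>UNIV. \<Sum>j\<in>UNIV. ?R $ i $ j)"
      by (intro member_le_sum) (auto simp: nonneg intro: sum_nonneg)
    finally show ?thesis
      by (simp add: inner_vec_def matrix_vector_mult_def)
  qed
  ultimately show False by simp
qed

section \<open>Curvature and the pointwise energy inequality\<close>

lemma resistance_mult_curvature:
  fixes E :: "'v::finite \<Rightarrow> 'v \<Rightarrow> bool"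
  assumes "symp E" and "connected_graph E" and "CARD('v) \<ge> 2"
  shows "resistance_matrix E *v resistance_curvature E = (\<chi> i. 1)"
proof -
  obtain B where B: "resistance_matrix E ** B = mat 1" "B ** resistance_matrix E = mat 1"
    using invertible_resistance_matrix[OF assms] by (auto simp: invertible_def)
  show ?thesis
    unfolding resistance_curvature_def
  proof (rule theI)
    show "resistance_matrix E *v (B *v (\<chi> i. 1)) = (\<chi> i. 1)"
      by (simp add: matrix_vector_mul_assoc B)
  next
    fix k assume "resistance_matrix E *v k = (\<chi> i. 1)"
    then have "B *v (\<chi> i. 1) = B *v (resistance_matrix E *v k)" by simp
    then show "k = B *v (\<chi> i. 1)"
      by (simp add: matrix_vector_mul_assoc B)
  qed
qed

lemma curvature_sum_square_diff_le:
  fixes E :: "'v::finite \<Rightarrow> 'v \<Rightarrow> bool"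
  assumes "symp E" and "connected_graph E" and "CARD('v) \<ge> 2"
    and "K > 0" and "\<And>v. resistance_curvature E $ v \<ge> K"
  shows "K * (\<Sum>v\<in>UNIV. (f $ u - f $ v)\<^sup>2) \<le> dirichlet_form E f f"
proof -
  let ?k = "resistance_curvature E"
  have "K * (\<Sum>v\<in>UNIV. (f $ u - f $ v)\<^sup>2)
      \<le> (\<Sum>v\<in>UNIV. ?k $ v * (resistance_matrix E $ u $ v * dirichlet_form E f f))"
    unfolding sum_distrib_left
    by (intro sum_mono mult_mono[OF assms(5) square_diff_le_resistance[OF assms(1,2)]])
       (use assms(4,5) in \<open>auto intro: order.trans[OF less_imp_le]\<close>)
  \<comment> \<open>The weights of the energy add up to entry \<open>u\<close> of resistance times
    curvature, which is 1.\<close>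
  also have "\<dots> = (resistance_matrix E *v ?k) $ u * dirichlet_form E f f"
    by (simp add: matrix_vector_mult_def sum_distrib_left mult_ac)
  finally show ?thesis
    by (simp add: resistance_mult_curvature[OF assms(1-3)])
qed

section \<open>Graph distance and the diameter bound\<close>

lemma graph_dist_walk:
  assumes "connected_graph E"
  shows "(E ^^ graph_dist E u v) u v"
proof -
  have "\<exists>k. (E ^^ k) u v"
    using assms by (auto simp: connected_graph_def intro: rtranclp_imp_relpowp)
  then show ?thesis
    unfolding graph_dist_def by (rule LeastI_ex)
qed

lemma graph_dist_le: "(E ^^ k) u v \<Longrightarrow> graph_dist E u v \<le> k"
  unfolding graph_dist_def by (rule Least_le)

lemma graph_dist_self [simp]: "graph_dist E u u = 0"
  using graph_dist_le[of 0 E u u] by simp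

lemma graph_dist_edge_le:
  assumes "connected_graph E" and "E v w"
  shows "graph_dist E u w \<le> Suc (graph_dist E u v)"
  using graph_dist_le[OF relpowp_Suc_I[OF graph_dist_walk[OF assms(1)] assms(2)]] .

text \<open>Every value from 0 to the distance is attained at some vertex, by descending along
  shortest walks.\<close>

lemma graph_dist_less_card:
  fixes E :: "'v::finite \<Rightarrow> 'v \<Rightarrow> bool"
  assumes "connected_graph E"
  shows "graph_dist E u v < CARD('v)"
proof -
  have "\<exists>w. graph_dist E u w = k" if "k \<le> graph_dist E u v" for k
    using that
  proof (induction k rule: inc_induct)
    case (step k)
    then obtain w where w: "graph_dist E u w = Suc k" by blast
    then have "(E ^^ Suc k) u w"
      using graph_dist_walk[OF assms, of u w] by simp
    then obtain x where x: "(E ^^ k) u x" "E x w" by (rule relpowp_Suc_E)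
    \<comment> \<open>A smaller distance is impossible: one more edge would reach \<open>w\<close>
      in fewer than \<open>Suc k\<close> steps.\<close>
    have "graph_dist E u x = k"
      using graph_dist_le[OF x(1)] graph_dist_edge_le[OF assms x(2), of u] w by simp
    then show ?case by blast
  qed blast
  then have "{..graph_dist E u v} \<subseteq> range (graph_dist E u)"
    by (metis atMost_iff rangeI subsetI)
  then have "card {..graph_dist E u v} \<le> card (range (graph_dist E u))"
    by (intro card_mono) auto
  also have "\<dots> \<le> CARD('v)"
    by (rule card_image_le) simp
  finally show ?thesis by simp
qed

lemma graph_dist_square_le:
  fixes E :: "'v::finite \<Rightarrow> 'v \<Rightarrow> bool"
  assumes "symp E" and "connected_graph E" and "CARD('v) \<ge> 2"
    and "K > 0" and "\<And>v. resistance_curvature E $ v \<ge> K"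
  shows "(real (graph_dist E x y))\<^sup>2 \<le> 2 * real (max_degree E) / K"
proof -
  define f :: "real ^ 'v" where "f = (\<chi> v. real (graph_dist E x v))"
  define D where "D = real (graph_dist E x y)"
  have f: "f $ x = 0" "f $ y = D"
    by (auto simp: f_def D_def)
  have "\<bar>f $ u - f $ v\<bar> \<le> 1" if "E u v" for u v
    using graph_dist_edge_le[OF assms(2) that, of x]
      graph_dist_edge_le[OF assms(2) sympD[OF assms(1) that], of x]
    by (simp add: f_def abs_le_iff)
  then have energy: "dirichlet_form E f f \<le> real CARD('v) * real (max_degree E) / 2"
    by (rule dirichlet_form_le_of_Lipschitz)
  \<comment> \<open>With t the value of \<open>f\<close> at \<open>v\<close>, the right side minus
    the left side is half the square of D - 2t.\<close>
  have "D\<^sup>2 / 2 \<le> (f $ x - f $ v)\<^sup>2 + (f $ y - f $ v)\<^sup>2" for v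
    using zero_le_power2[of "D - 2 * f $ v"] unfolding f
    by (simp add: power2_eq_square algebra_simps)
  then have "(\<Sum>v\<in>(UNIV::'v set). D\<^sup>2 / 2) \<le> (\<Sum>v\<in>UNIV. (f $ x - f $ v)\<^sup>2 + (f $ y - f $ v)\<^sup>2)"
    by (intro sum_mono)
  then have "K * (real CARD('v) * (D\<^sup>2 / 2))
      \<le> K * (\<Sum>v\<in>UNIV. (f $ x - f $ v)\<^sup>2) + K * (\<Sum>v\<in>UNIV. (f $ y - f $ v)\<^sup>2)"
    using assms(4) by (simp add: sum.distrib flip: distrib_left)
  \<comment> \<open>\<open>K\<close> times each sum is at most the energy, which is at most half of
    this bound.\<close>
  also have "\<dots> \<le> real CARD('v) * real (max_degree E)"
    using energy curvature_sum_square_diff_le[OF assms, of f x]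
      curvature_sum_square_diff_le[OF assms, of f y] by simp
  finally have "real CARD('v) * (K * D\<^sup>2) \<le> real CARD('v) * (2 * real (max_degree E))"
    by (simp add: algebra_simps)
  then show ?thesis
    using assms(4) by (simp add: D_def field_simps)
qed

section \<open>Comparison with the logarithm\<close>

text \<open>The rational function is the [1/1] Pade approximant at 1. Both sides agree there, and
  the derivative of the difference is a square over a positive term.\<close>

lemma ln_ge_Pade:
  fixes x :: real
  assumes "1 \<le> x"
  shows "2 * (x - 1) / (x + 1) \<le> ln x"
proof -
  have "ln 1 - 2 * (1 - 1) / (1 + 1) \<le> ln x - 2 * (x - 1) / (x + 1)"
  proof (rule DERIV_nonneg_imp_nondecreasing[OF assms])
    fix t :: real assume t: "1 \<le> t" "t \<le> x"
    have "((\<lambda>x. ln x - 2 * (x - 1) / (x + 1)) has_real_derivative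
        1 / t - (2 * (t + 1) - 2 * (t - 1)) / ((t + 1) * (t + 1))) (at t)"
      using t by (auto intro!: derivative_eq_intros)
    moreover have "1 / t - (2 * (t + 1) - 2 * (t - 1)) / ((t + 1) * (t + 1))
        = (t - 1)\<^sup>2 / (t * (t + 1)\<^sup>2)"
      using t by (simp add: divide_simps) (simp add: power2_eq_square algebra_simps)
    ultimately show "\<exists>y. ((\<lambda>x. ln x - 2 * (x - 1) / (x + 1)) has_real_derivative y) (at t) \<and> 0 \<le> y"
      using t by auto
  qed
  then show ?thesis by simp
qed

text \<open>Together with \<open>D \<le> sqrt 2 * a\<close> this gives
  \<open>D - 1 < a * ln n\<close>; the 1 is the slack gained by rounding up. One estimate serves
  small and large \<open>n\<close> alike.\<close>

lemma sqrt2_mult_less_mult_ln: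
  fixes D n :: real
  assumes "0 \<le> D" "D \<le> n - 1" "2 \<le> n"
  shows "sqrt 2 * (D - 1) < D * ln n"
proof (cases "D \<le> 1")
  case True
  have "0 < ln n" using assms by simp
  show ?thesis
  proof (cases "D = 1")
    case False
    then have "sqrt 2 * (D - 1) < 0" using True by (simp add: mult_pos_neg)
    also have "0 \<le> D * ln n" using assms \<open>0 < ln n\<close> by simp
    finally show ?thesis .
  qed (use \<open>0 < ln n\<close> in simp)
next
  case False
  have "sqrt 2 \<le> 3 / 2"
    by (rule real_le_lsqrt) (auto simp: power2_eq_square)
  then have "sqrt 2 * (D - 1) \<le> 3 / 2 * (D - 1)"
    using False by (intro mult_right_mono) auto
  also have "\<dots> < D * (2 * (n - 1) / (n + 1))"
  proof -
    \<comment> \<open>The goal with denominators cleared. For \<open>n \<le> 7\<close> the worst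
      case is \<open>D = n - 1\<close>.\<close>
    have "D * (7 - n) < 3 * (n + 1)"
    proof (cases "n \<le> 7")
      case True
      have "D * (7 - n) \<le> (n - 1) * (7 - n)"
        using True assms by (intro mult_right_mono) auto
      \<comment> \<open>This is \<open>3 * (n + 1) - (n - 1) * (7 - n)\<close> with the square
        completed.\<close>
      moreover have "0 < (n - 5 / 2)\<^sup>2 + 15 / 4"
        by (intro add_nonneg_pos) auto
      ultimately show ?thesis
        by (simp add: power2_eq_square algebra_simps)
    next
      case False
      then have "D * (7 - n) \<le> 0" using assms by (intro mult_nonneg_nonpos) auto
      also have "0 < 3 * (n + 1)" using assms by simp
      finally show ?thesis .
    qed
    then show ?thesis using assms by (simp add: field_simps)
  qed
  also have "\<dots> \<le> D * ln n"
    using False assms ln_ge_Pade[of n] by (intro mult_left_mono) auto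
  finally show ?thesis .
qed

theorem theorem1:
  fixes E :: "'v::finite \<Rightarrow> 'v \<Rightarrow> bool" and K :: real
  assumes "simple_graph E" and "connected_graph E" and "CARD('v) \<ge> 2"
    and "K > 0" and "\<And>v. resistance_curvature E $ v \<ge> K"
  shows "int (graph_diam E) \<le> \<lceil>sqrt (real (max_degree E) / K) * ln (real CARD('v))\<rceil>"
proof -
  have sym: "symp E"
    using assms(1) by (simp add: simple_graph_def)
  have "graph_diam E \<in> range (\<lambda>(u, v). graph_dist E u v)"
    unfolding graph_diam_def by (rule Max_in) auto
  then obtain x y where xy: "graph_diam E = graph_dist E x y" by auto
  define D where "D = real (graph_diam E)"
  define a where "a = sqrt (real (max_degree E) / K)"
  have "D\<^sup>2 \<le> 2 * real (max_degree E) / K"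
    unfolding D_def xy by (rule graph_dist_square_le[OF sym assms(2-5)])
  then have "D \<le> sqrt 2 * a"
    by (simp add: a_def real_le_rsqrt flip: real_sqrt_mult)
  moreover have "sqrt 2 * (D - 1) < D * ln (real CARD('v))"
    using graph_dist_less_card[OF assms(2), of x y] assms(3)
    by (intro sqrt2_mult_less_mult_ln) (auto simp: D_def xy)
  moreover have "0 \<le> ln (real CARD('v))"
    by simp
  ultimately have "sqrt 2 * (D - 1) < sqrt 2 * (a * ln (real CARD('v)))"
    by (smt (verit) mult.assoc mult_right_mono)
  then have "D - 1 < a * ln (real CARD('v))"
    by simp
  \<comment> \<open>The diameter is an integer, so lying less than 1 above a real puts it at or
    below the ceiling of that real.\<close>
  then show ?thesis
    unfolding D_def a_def by linarith
qed

end
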